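(* Let $g_1,\dots,g_m:\mathbb{R}^n\to\mathbb{R}$ be convex, $Y\subseteq\mathbb{R}^n$ closed and convex, $X=\bigcap_{i=1}^m\{x\in\mathbb{R}^n:g_i(x)\le0\}$, $X\cap Y\ne\emptyset$, and let $h(x)=\max_{1\le i\le m}g_i(x)+\delta_Y(x)$. Assume the Strong Slater condition $0\notin\mathrm{cl}(\partial h(h^{-1}(0)))$ and let $$\gamma=\frac{1}{\mathrm{dist}\left(0,\mathrm{cl}(\partial h(h^{-1}(0)))\right)}.$$ Then for every $x\in Y$ with $x\notin X\cap Y$, every optimal Lagrangian dual multiplier $\mu_x^*$ of the projection problem $$\text{minimize }\|x-y\|\quad\text{subject to }h(y)\le0$$ satisfies $\mu_x^*\le\gamma$; and for every $x\in X\cap Y$, $\mu_x^*=0$ is an optimal dual multiplier of this problem. Consequently, optimal multipliers of the projection problems can be chosen so that $\mu_x^*\le\gamma$ uniformly over all $x\in Y$ (no compactness of $Y$ is assumed).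
   Context: $\delta_Y(x)=0$ if $x\in Y$ and $+\infty$ otherwise; $h^{-1}(0)=\{z: h(z)=0\}$; $\partial h(S)=\bigcup_{z\in S}\partial h(z)$, where $\partial h$ is the convex subdifferential; $\mathrm{cl}$ denotes closure; norms are Euclidean, $\mathrm{dist}(0,S)=\inf_{s\in S}\|s\|$ (with $\mathrm{dist}(0,\emptyset)=+\infty$, $1/\infty=0$). The Lagrangian of the projection problem is $\mathcal L_x(y,\mu)=\|x-y\|+\mu h(y)$ for $y\in\mathbb{R}^n$, $\mu\ge0$; an optimal Lagrangian dual multiplier is a maximizer $\mu\ge0$ of $\inf_{y\in\mathbb{R}^n}\mathcal L_x(y,\mu)$ (under the Strong Slater condition the Slater condition holds, so such multipliers exist with zero duality gap). *)

theory Defs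
  imports "HOL-Analysis.Analysis"
begin

definition delta_fun :: "'a set \<Rightarrow> 'a \<Rightarrow> ereal" where
  "delta_fun Y x = (if x \<in> Y then 0 else \<infinity>)"

(* Max is meaningful only over a nonempty index set: m \<ge> 1 is assumed wherever this is used. *)
definition penalty_fun :: "nat \<Rightarrow> (nat \<Rightarrow> 'a \<Rightarrow> real) \<Rightarrow> 'a set \<Rightarrow> 'a \<Rightarrow> ereal" where
  "penalty_fun m g Y x = ereal (MAX i\<in>{1..m}. g i x) + delta_fun Y x"

(* Convex subdifferential of an extended-valued function; it is empty at points
   where the function is not finite. *)
definition subdiff :: "('a::real_inner \<Rightarrow> ereal) \<Rightarrow> 'a \<Rightarrow> 'a set" where
  "subdiff h z = {v. \<bar>h z\<bar> \<noteq> \<infinity> \<and> (\<forall>y. h z + ereal (inner v (y - z)) \<le> h y)}"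

definition subdiff_on :: "('a::real_inner \<Rightarrow> ereal) \<Rightarrow> 'a set \<Rightarrow> 'a set" where
  "subdiff_on h S = (\<Union>z\<in>S. subdiff h z)"

(* The library's infdist and setdist give 0 for the empty set; here the value is \<infinity>. *)
definition dist_zero :: "'a::real_normed_vector set \<Rightarrow> ereal" where
  "dist_zero S = (INF s\<in>S. ereal (norm s))"

definition strong_slater :: "('a::real_inner \<Rightarrow> ereal) \<Rightarrow> bool" where
  "strong_slater h \<longleftrightarrow> 0 \<notin> closure (subdiff_on h (h -` {0}))"

(* Division in ereal satisfies 1 / \<infinity> = 0. *)
definition slater_gamma :: "('a::real_inner \<Rightarrow> ereal) \<Rightarrow> ereal" where
  "slater_gamma h = 1 / dist_zero (closure (subdiff_on h (h -` {0})))"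

(* In ereal 0 * \<infinity> = 0, so for \<mu> = 0 the Lagrangian is norm (x - y) for every y, also where
   h y = \<infinity>. For x in Y the dual value at \<mu> = 0 is 0 under the convention
   0 * \<infinity> = \<infinity> as well, because the infimum is attained at y = x, where h x is finite. *)
definition proj_lagrangian ::
  "('a::real_normed_vector \<Rightarrow> ereal) \<Rightarrow> 'a \<Rightarrow> 'a \<Rightarrow> real \<Rightarrow> ereal" where
  "proj_lagrangian h x y \<mu> = ereal (norm (x - y)) + ereal \<mu> * h y"

definition proj_dual :: "('a::real_normed_vector \<Rightarrow> ereal) \<Rightarrow> 'a \<Rightarrow> real \<Rightarrow> ereal" where
  "proj_dual h x \<mu> = (INF y. proj_lagrangian h x y \<mu>)"

definition optimal_multiplier :: "('a::real_normed_vector \<Rightarrow> ereal) \<Rightarrow> 'a \<Rightarrow> real \<Rightarrow> bool" where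
  "optimal_multiplier h x \<mu> \<longleftrightarrow> 0 \<le> \<mu> \<and> (\<forall>\<nu>\<ge>0. proj_dual h x \<nu> \<le> proj_dual h x \<mu>)"

end

theory Submission
  imports Defs
begin

text \<open>Let \<open>p\<close> be the projection of \<open>x \<in> Y - X\<close> onto \<open>X \<inter> Y\<close> and \<open>u = x - p\<close>. Then \<open>h p = 0\<close> and the
  half-space \<open>{y. u \<bullet> (y - p) \<ge> 0}\<close> is disjoint from \<open>{h < 0}\<close>, so a one-dimensional separation along
  \<open>u\<close> yields \<open>\<lambda> > 0\<close> with \<open>\<lambda> u \<in> \<partial>h(p)\<close>; the multiplier \<open>1 / (\<lambda> \<parallel>u\<parallel>)\<close> attains dual value \<open>\<parallel>u\<parallel>\<close>,
  which bounds all dual values. Conversely, for any optimal multiplier \<open>\<mu>\<close> the point \<open>p\<close> minimizes the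
  Lagrangian, so its first-order condition puts \<open>u / (\<mu> \<parallel>u\<parallel>)\<close>, a vector of norm \<open>1 / \<mu>\<close>, into
  \<open>\<partial>h(h\<^sup>-\<^sup>1(0))\<close>.\<close>

section \<open>Real convex functions: separation, first-order condition, projection onto a sublevel
  set\<close>

lemma convex_on_Max:
  assumes "finite I" "I \<noteq> {}" and "\<And>i. i \<in> I \<Longrightarrow> convex_on S (g i)"
  shows "convex_on S (\<lambda>x. MAX i\<in>I. g i x :: real)"
  using assms
proof (induction I rule: finite_ne_induct)
  case (singleton i)
  then show ?case by simp
next
  case (insert i I)
  have "convex_on S (g i)" and "convex_on S (\<lambda>x. MAX i\<in>I. g i x)"
    using insert by auto
  then have "convex_on S (\<lambda>x. max (g i x) (MAX i\<in>I. g i x))"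
    unfolding convex_on_def by (smt (verit, best) mult_left_mono)
  then show ?case using insert by simp
qed

text \<open>Convexity bounds the growth of \<open>F\<close> along the segment linearly, so a short
  step keeps it negative. This serves to perturb a strictly feasible point towards an infeasible
  one.\<close>

lemma convex_on_neg_segment:
  fixes F :: "'a::real_vector \<Rightarrow> real"
  assumes "convex_on Y F" "z \<in> Y" "x \<in> Y" "F z < 0"
  obtains t where "0 < t" "t \<le> 1" "z + t *\<^sub>R (x - z) \<in> Y" "F (z + t *\<^sub>R (x - z)) < 0"
proof -
  \<comment> \<open>With this \<open>t\<close> the growth bound
    \<open>t * (\<bar>F x\<bar> - F z)\<close> is half of \<open>- F z\<close>; the absolute value
    keeps the denominator positive whatever the sign of \<open>F x\<close>.\<close>
  define t where "t = - F z / (2 * (\<bar>F x\<bar> - F z))"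
  have t: "0 < t" "t \<le> 1" "t * (\<bar>F x\<bar> - F z) = - F z / 2"
    using assms(4) by (auto simp: t_def divide_simps)
  have eq: "z + t *\<^sub>R (x - z) = (1 - t) *\<^sub>R z + t *\<^sub>R x"
    by (simp add: algebra_simps)
  have "F (z + t *\<^sub>R (x - z)) \<le> (1 - t) * F z + t * F x"
    unfolding eq using assms t by (intro convex_onD) auto
  also have "\<dots> \<le> F z + t * (\<bar>F x\<bar> - F z)"
    using mult_left_mono[OF abs_ge_self[of "F x"], of t] t(1) by (simp add: algebra_simps)
  also have "\<dots> < 0"
    using t(3) assms(4) by simp
  finally have neg: "F (z + t *\<^sub>R (x - z)) < 0" .
  have "z + t *\<^sub>R (x - z) \<in> Y"
    unfolding eq using convex_on_imp_convex[OF assms(1)] assms(2,3) t by (simp add: convex_alt)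
  with neg t that show thesis by blast
qed

text \<open>With \<open>s y = u \<bullet> (y - p)\<close>, every slope \<open>F y / s y\<close> from
  the side \<open>s < 0\<close> is at most every slope from the side \<open>s > 0\<close>, so some
  \<open>l\<close> separates them. When \<open>F p = 0\<close>, \<open>l *\<^sub>R u\<close> is a
  subgradient at \<open>p\<close> of \<open>F\<close> restricted to \<open>Y\<close>.\<close>

lemma normal_to_sublevel_imp_scaled_subgradient:
  fixes F :: "'a::real_inner \<Rightarrow> real"
  assumes F: "convex_on Y F"
    and normal: "\<And>y. y \<in> Y \<Longrightarrow> F y \<le> 0 \<Longrightarrow> u \<bullet> (y - p) \<le> 0"
    and x: "x \<in> Y" "0 < u \<bullet> (x - p)"
    and y0: "y0 \<in> Y" "F y0 < 0"
  obtains l where "0 < l" "\<And>y. y \<in> Y \<Longrightarrow> l * (u \<bullet> (y - p)) \<le> F y"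
proof -
  define s where "s y = u \<bullet> (y - p)" for y
  \<comment> \<open>Otherwise a short step from \<open>z\<close> towards \<open>x\<close> keeps
    \<open>F\<close> negative and makes \<open>s\<close> strictly positive, against
    \<open>normal\<close>.\<close>
  have nonneg: "0 \<le> F z" if z: "z \<in> Y" "0 \<le> s z" for z
  proof (rule ccontr)
    assume "\<not> 0 \<le> F z"
    then obtain t where t: "0 < t" "t \<le> 1" "z + t *\<^sub>R (x - z) \<in> Y" "F (z + t *\<^sub>R (x - z)) < 0"
      using convex_on_neg_segment[OF F z(1) x(1)] by force
    then have "s (z + t *\<^sub>R (x - z)) \<le> 0"
      using normal by (force simp: s_def)
    moreover have "s (z + t *\<^sub>R (x - z)) = (1 - t) * s z + t * s x"
      by (simp add: s_def inner_diff_right inner_add_right algebra_simps)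
    moreover have "0 \<le> (1 - t) * s z" "0 < t * s x"
      using t z x by (auto simp: s_def)
    ultimately show False by linarith
  qed
  have cross: "F y / s y \<le> F y' / s y'" if y: "y \<in> Y" "s y < 0" "y' \<in> Y" "0 < s y'" for y y'
  proof -
    \<comment> \<open>The weight at which the segment from \<open>y\<close> to \<open>y'\<close>
      crosses the hyperplane \<open>s = 0\<close>, where \<open>nonneg\<close> applies.\<close>
    define a where "a = - s y / (s y' - s y)"
    have a: "0 \<le> a" "a \<le> 1" "a * (s y' - s y) = - s y"
      using y by (auto simp: a_def divide_simps)
    define z where "z = (1 - a) *\<^sub>R y + a *\<^sub>R y'"
    have "z \<in> Y"
      unfolding z_def using convex_on_imp_convex[OF F] y a by (simp add: convex_alt)
    moreover have "s z = s y + a * (s y' - s y)"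
      by (simp add: s_def z_def inner_diff_right inner_add_right algebra_simps)
    ultimately have "0 \<le> F z"
      using nonneg a by simp
    also have "F z \<le> (1 - a) * F y + a * F y'"
      unfolding z_def using F y a by (intro convex_onD) auto
    finally have "0 \<le> ((1 - a) * F y + a * F y') * (s y' - s y)"
      using y by simp
    also have "\<dots> = F y * (s y' - s y) + (a * (s y' - s y)) * (F y' - F y)"
      by (simp add: algebra_simps)
    also have "\<dots> = F y * s y' - s y * F y'"
      unfolding a(3) by (simp add: algebra_simps)
    finally show ?thesis
      using y by (simp add: divide_simps mult.commute)
  qed
  have y0s: "s y0 < 0"
    using nonneg[OF y0(1)] y0(2) by force
  \<comment> \<open>The supremum is over a nonempty set because of \<open>y0\<close>, whose positive
    slope also gives \<open>0 < l\<close>; it is bounded by the slope at \<open>x\<close>.\<close>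
  define l where "l = (SUP y\<in>{y \<in> Y. s y < 0}. F y / s y)"
  have upper: "F y / s y \<le> F x / s x" if "y \<in> Y" "s y < 0" for y
    using cross[of y x] that x by (simp add: s_def)
  then have bdd: "bdd_above ((\<lambda>y. F y / s y) ` {y \<in> Y. s y < 0})"
    by (auto intro!: bdd_aboveI2)
  have l_ge: "F y / s y \<le> l" if "y \<in> Y" "s y < 0" for y
    unfolding l_def using that by (intro cSUP_upper bdd) auto
  have l_le: "l \<le> F y' / s y'" if "y' \<in> Y" "0 < s y'" for y'
    unfolding l_def using that y0 y0s cross by (intro cSUP_least) auto
  have "0 < F y0 / s y0"
    using y0 y0s by (simp add: divide_neg_neg)
  then have "0 < l"
    using l_ge[OF y0(1) y0s] by linarith
  moreover have "l * s y \<le> F y" if y: "y \<in> Y" for y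
  proof (cases "s y" "0::real" rule: linorder_cases)
    case less
    then show ?thesis using l_ge[OF y less] by (simp add: divide_simps)
  next
    case equal
    then show ?thesis using nonneg[OF y] by simp
  next
    case greater
    then show ?thesis using l_le[OF y greater] by (simp add: divide_simps)
  qed
  ultimately show thesis
    using that by (auto simp: s_def)
qed

text \<open>Minimality of \<open>p\<close> is tested at points moving from \<open>p\<close> towards
  \<open>y\<close>. The derivative of the norm at \<open>x - p\<close> comes from an explicit
  quotient, and convexity with \<open>F p = 0\<close> bounds the other term by
  \<open>t * F y\<close>.\<close>

lemma first_order_norm_add_convex:
  fixes F :: "'a::real_inner \<Rightarrow> real"
  assumes F: "convex_on Y F" and p: "p \<in> Y" "F p = 0" and y: "y \<in> Y"
    and \<mu>: "0 \<le> \<mu>" and u: "x \<noteq> p"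
    and min: "\<And>y. y \<in> Y \<Longrightarrow> norm (x - p) \<le> norm (x - y) + \<mu> * F y"
  shows "(x - p) \<bullet> (y - p) / norm (x - p) \<le> \<mu> * F y"
proof -
  define u where "u = x - p"
  define w where "w = y - p"
  have u0: "u \<noteq> 0" using u by (simp add: u_def)
  have bound: "(2 * (u \<bullet> w) - t * (w \<bullet> w)) / (norm u + norm (u - t *\<^sub>R w)) \<le> \<mu> * F y"
    if t: "0 < t" "t < 1" for t
  proof -
    define q where "q = (1 - t) *\<^sub>R p + t *\<^sub>R y"
    have "q \<in> Y"
      unfolding q_def using convex_on_imp_convex[OF F] p y t by (simp add: convex_alt)
    then have "norm u \<le> norm (x - q) + \<mu> * F q"
      unfolding u_def by (rule min)
    moreover have "x - q = u - t *\<^sub>R w"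
      by (simp add: q_def u_def w_def algebra_simps)
    moreover have "F q \<le> t * F y"
      using convex_onD[OF F, of t p y] p y t by (simp add: q_def)
    then have "\<mu> * F q \<le> \<mu> * (t * F y)"
      using \<mu> by (rule mult_left_mono)
    ultimately have "norm u - norm (u - t *\<^sub>R w) \<le> t * (\<mu> * F y)"
      by (simp add: algebra_simps)
    \<comment> \<open>The sum of the norms turns their difference into a difference of squares, from
      which the factor \<open>t\<close> can be cancelled.\<close>
    then have "(norm u - norm (u - t *\<^sub>R w)) * (norm u + norm (u - t *\<^sub>R w))
        \<le> t * (\<mu> * F y) * (norm u + norm (u - t *\<^sub>R w))"
      by (intro mult_right_mono) auto
    moreover have "(norm u - norm (u - t *\<^sub>R w)) * (norm u + norm (u - t *\<^sub>R w))
        = t * (2 * (u \<bullet> w) - t * (w \<bullet> w))"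
    proof -
      have "(norm u - norm (u - t *\<^sub>R w)) * (norm u + norm (u - t *\<^sub>R w))
          = (norm u)\<^sup>2 - (norm (u - t *\<^sub>R w))\<^sup>2"
        by (simp add: power2_eq_square algebra_simps)
      also have "\<dots> = t * (2 * (u \<bullet> w) - t * (w \<bullet> w))"
        unfolding power2_norm_eq_inner
        by (simp add: inner_diff_left inner_diff_right inner_commute algebra_simps)
      finally show ?thesis .
    qed
    ultimately have "2 * (u \<bullet> w) - t * (w \<bullet> w) \<le> \<mu> * F y * (norm u + norm (u - t *\<^sub>R w))"
      using t by (simp add: mult.assoc)
    moreover have "0 < norm u + norm (u - t *\<^sub>R w)"
      using u0 by (simp add: add_pos_nonneg)
    ultimately show ?thesis by (simp add: pos_divide_le_eq)
  qed
  have "((\<lambda>t. (2 * (u \<bullet> w) - t * (w \<bullet> w)) / (norm u + norm (u - t *\<^sub>R w)))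
      \<longlongrightarrow> (2 * (u \<bullet> w) - 0 * (w \<bullet> w)) / (norm u + norm (u - 0 *\<^sub>R w))) (at_right 0)"
    using u0 by (intro tendsto_intros) auto
  moreover have "\<forall>\<^sub>F t in at_right 0.
      (2 * (u \<bullet> w) - t * (w \<bullet> w)) / (norm u + norm (u - t *\<^sub>R w)) \<le> \<mu> * F y"
    unfolding eventually_at_right_field using bound by (intro exI[of _ 1]) auto
  ultimately have "(2 * (u \<bullet> w) - 0 * (w \<bullet> w)) / (norm u + norm (u - 0 *\<^sub>R w)) \<le> \<mu> * F y"
    by (intro tendsto_upperbound) auto
  then show ?thesis by (simp add: u_def w_def)
qed

text \<open>The closest point has \<open>F p = 0\<close>: if \<open>F p < 0\<close>, a short step
  towards \<open>x\<close> would remain in the sublevel set and violate the obtuse angle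
  inequality.\<close>

lemma obtain_projection_on_sublevel:
  fixes F :: "'a::euclidean_space \<Rightarrow> real"
  assumes F: "convex_on Y F" "continuous_on Y F" and Y: "closed Y"
    and ne: "y0 \<in> Y" "F y0 \<le> 0" and x: "x \<in> Y" "0 < F x"
  obtains p where "p \<in> Y" "F p = 0" "x \<noteq> p"
    "\<And>y. y \<in> Y \<Longrightarrow> F y \<le> 0 \<Longrightarrow> (x - p) \<bullet> (y - p) \<le> 0"
proof -
  define C where "C = {y \<in> Y. F y \<le> 0}"
  have "closed C"
    unfolding C_def using F(2) Y by (intro continuous_on_closed_Collect_le) auto
  have "convex C"
    unfolding C_def using convex_on_imp_convex[OF F(1)] F(1)
    by (auto simp: convex_alt intro!: order_trans[OF convex_onD[OF F(1)]]
        add_nonpos_nonpos mult_nonneg_nonpos)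
  define p where "p = closest_point C x"
  have "C \<noteq> {}" using ne by (auto simp: C_def)
  then have pC: "p \<in> C"
    unfolding p_def using \<open>closed C\<close> by (intro closest_point_in_set)
  have normal: "(x - p) \<bullet> (y - p) \<le> 0" if "y \<in> Y" "F y \<le> 0" for y
    unfolding p_def using that \<open>closed C\<close> \<open>convex C\<close>
    by (intro closest_point_dot) (auto simp: C_def)
  have xp: "x \<noteq> p" using x pC by (auto simp: C_def)
  have "\<not> F p < 0"
  proof
    assume "F p < 0"
    then obtain t where t: "0 < t" "p + t *\<^sub>R (x - p) \<in> Y" "F (p + t *\<^sub>R (x - p)) < 0"
      using convex_on_neg_segment[OF F(1) _ x(1)] pC by (force simp: C_def)
    then have "t * ((x - p) \<bullet> (x - p)) \<le> 0"
      using normal[of "p + t *\<^sub>R (x - p)"] by simp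
    moreover have "0 < t * ((x - p) \<bullet> (x - p))"
      using t xp by simp
    ultimately show False by linarith
  qed
  then show thesis
    using that pC normal xp by (force simp: C_def)
qed

section \<open>The Strong Slater condition and its constant\<close>

lemma dist_zero_pos:
  assumes "closed S" "0 \<notin> S"
  shows "0 < dist_zero S"
proof -
  obtain e where e: "0 < e" "ball 0 e \<subseteq> - S"
    using assms by (metis Compl_iff open_Compl openE)
  then have "ereal e \<le> dist_zero S"
    unfolding dist_zero_def by (intro INF_greatest) (force simp: subset_iff)
  with e show ?thesis
    by (metis ereal_less(2) less_le_trans)
qed

lemma slater_gamma_props:
  assumes "strong_slater h"
  shows "0 \<le> slater_gamma h" "slater_gamma h < \<infinity>"
    and "\<lbrakk>v \<in> subdiff h z; h z = 0\<rbrakk> \<Longrightarrow> ereal (1 / norm v) \<le> slater_gamma h"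
proof -
  let ?S = "closure (subdiff_on h (h -` {0}))"
  have 0: "0 \<notin> ?S"
    using assms by (simp add: strong_slater_def)
  then have pos: "0 < dist_zero ?S"
    by (intro dist_zero_pos) auto
  show "0 \<le> slater_gamma h" "slater_gamma h < \<infinity>"
    \<comment> \<open>An infinite distance, as for an empty set of subgradients, gives the value
      0.\<close>
    unfolding slater_gamma_def using pos by (cases "dist_zero ?S"; simp)+
  assume v: "v \<in> subdiff h z" "h z = 0"
  then have vS: "v \<in> ?S"
    by (intro closure_subset[THEN subsetD]) (auto simp: subdiff_on_def)
  then have "dist_zero ?S \<le> ereal (norm v)"
    unfolding dist_zero_def by (rule INF_lower)
  with pos obtain d where d: "dist_zero ?S = ereal d" "0 < d" "d \<le> norm v"
    by (cases "dist_zero ?S") auto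
  then show "ereal (1 / norm v) \<le> slater_gamma h"
    unfolding slater_gamma_def by (simp add: one_ereal_def frac_le)
qed

text \<open>If \<open>h\<close> were nonnegative everywhere, \<open>z\<close> would be a minimizer
  with value 0, making 0 a subgradient at a zero of \<open>h\<close>.\<close>

lemma strong_slater_imp_slater:
  assumes ss: "strong_slater h" and z: "h z \<le> 0"
  obtains y where "h y < 0"
proof (rule ccontr)
  assume "\<not> thesis"
  then have ge: "0 \<le> h y" for y
    using that by (meson not_le)
  then have "h z = 0"
    using z by (simp add: order_antisym)
  then have "0 \<in> subdiff_on h (h -` {0})"
    using ge by (auto simp: subdiff_on_def subdiff_def simp flip: zero_ereal_def intro!: exI[of _ z])
  then show False
    using ss closure_subset unfolding strong_slater_def by blast
qed

section \<open>Multipliers of the projection problems\<close>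

theorem mainTheorem8:
  fixes m :: nat
    and g :: "nat \<Rightarrow> real ^ 'n \<Rightarrow> real"
    and X Y :: "(real ^ 'n) set"
    and h :: "real ^ 'n \<Rightarrow> ereal"
    and \<gamma> :: ereal
  assumes "m \<ge> 1"
    and "\<And>i. i \<in> {1..m} \<Longrightarrow> convex_on UNIV (g i)"
    and "closed Y" and "convex Y"
    and "X = (\<Inter>i\<in>{1..m}. {x. g i x \<le> 0})"
    and "X \<inter> Y \<noteq> {}"
    and "h = penalty_fun m g Y"
    and "strong_slater h"
    and "\<gamma> = slater_gamma h"
  shows "(\<forall>x\<in>Y. x \<notin> X \<inter> Y \<longrightarrow> (\<forall>\<mu>. optimal_multiplier h x \<mu> \<longrightarrow> ereal \<mu> \<le> \<gamma>))
       \<and> (\<forall>x\<in>X \<inter> Y. optimal_multiplier h x 0)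
       \<and> \<gamma> < \<infinity>
       \<and> (\<exists>\<mu> :: real ^ 'n \<Rightarrow> real. \<forall>x\<in>Y. optimal_multiplier h x (\<mu> x) \<and> ereal (\<mu> x) \<le> \<gamma>)"
proof -
  define F where "F y = (MAX i\<in>{1..m}. g i y)" for y
  have h: "h y = (if y \<in> Y then ereal (F y) else \<infinity>)" for y
    by (simp add: assms(7) penalty_fun_def delta_fun_def F_def)
  have "convex_on UNIV F"
    unfolding F_def using assms(1,2) by (intro convex_on_Max) auto
  then have F: "convex_on Y F" "continuous_on Y F"
    using assms(4) by (auto intro: convex_on_subset continuous_on_subset convex_on_continuous)
  have X: "y \<in> X \<longleftrightarrow> F y \<le> 0" for y
    using assms(1) by (simp add: assms(5) F_def)
  obtain z where z: "z \<in> Y" "F z \<le> 0"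
    using assms(6) X by auto
  obtain y0 where "h y0 < 0"
    using strong_slater_imp_slater[OF assms(8), of z] z by (auto simp: h)
  then have y0: "y0 \<in> Y" "F y0 < 0"
    by (auto simp: h split: if_splits)
  note \<gamma> = slater_gamma_props[OF assms(8), folded assms(9)]
  have inside: "optimal_multiplier h x 0" if x: "x \<in> X \<inter> Y" for x
  proof -
    have "proj_dual h x \<nu> \<le> 0" if "\<nu> \<ge> 0" for \<nu>
    proof -
      have "proj_dual h x \<nu> \<le> proj_lagrangian h x x \<nu>"
        unfolding proj_dual_def by (rule INF_lower) simp
      also have "\<dots> \<le> 0"
        using x that by (simp add: proj_lagrangian_def h X mult_nonneg_nonpos)
      finally show ?thesis .
    qed
    moreover have "0 \<le> proj_dual h x 0"
      unfolding proj_dual_def by (intro INF_greatest) (simp add: proj_lagrangian_def flip: zero_ereal_def)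
    ultimately show ?thesis
      unfolding optimal_multiplier_def by (meson order_refl order_trans)
  qed
  have outside: "(\<exists>\<mu>. optimal_multiplier h x \<mu>) \<and>
      (\<forall>\<mu>. optimal_multiplier h x \<mu> \<longrightarrow> ereal \<mu> \<le> \<gamma>)" if x: "x \<in> Y" "x \<notin> X \<inter> Y" for x
  proof -
    have Fx: "0 < F x" using x X by auto
    obtain p where p: "p \<in> Y" "F p = 0" "x \<noteq> p"
      and normal: "\<And>y. y \<in> Y \<Longrightarrow> F y \<le> 0 \<Longrightarrow> (x - p) \<bullet> (y - p) \<le> 0"
      using obtain_projection_on_sublevel[OF F assms(3) z x(1) Fx] by blast
    define u where "u = x - p"
    have u: "0 < norm u" using p by (simp add: u_def)
    \<comment> \<open>Since \<open>h p = 0\<close>, the Lagrangian at \<open>p\<close> does not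
      depend on the multiplier.\<close>
    have dual_le: "proj_dual h x \<nu> \<le> ereal (norm u)" for \<nu>
    proof -
      have "proj_dual h x \<nu> \<le> proj_lagrangian h x p \<nu>"
        unfolding proj_dual_def by (rule INF_lower) simp
      also have "\<dots> = ereal (norm u)"
        using p by (simp add: proj_lagrangian_def h u_def)
      finally show ?thesis .
    qed
    have "0 < u \<bullet> (x - p)" using u by (simp add: u_def)
    then obtain l where l: "0 < l" "\<And>y. y \<in> Y \<Longrightarrow> l * (u \<bullet> (y - p)) \<le> F y"
      using normal_to_sublevel_imp_scaled_subgradient[OF F(1) _ x(1) _ y0] normal
      unfolding u_def by blast
    \<comment> \<open>This factor scales the subgradient \<open>l *\<^sub>R u\<close> of
      \<open>h\<close> at \<open>p\<close> to the unit vector along \<open>u\<close>, balancing the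
      slope of the distance at \<open>p\<close>.\<close>
    define \<mu>0 where "\<mu>0 = 1 / (l * norm u)"
    have \<mu>0: "0 < \<mu>0" using l u by (simp add: \<mu>0_def)
    have dual_ge: "ereal (norm u) \<le> proj_dual h x \<mu>0"
      unfolding proj_dual_def
    proof (rule INF_greatest)
      fix y
      show "ereal (norm u) \<le> proj_lagrangian h x y \<mu>0"
      proof (cases "y \<in> Y")
        case True
        have "u \<bullet> (y - p) = u \<bullet> u - u \<bullet> (x - y)"
          by (simp add: u_def inner_diff_right)
        also have "\<dots> \<ge> norm u * norm u - norm u * norm (x - y)"
          using norm_cauchy_schwarz[of u "x - y"] by (simp add: dot_square_norm power2_eq_square)
        finally have "norm u - norm (x - y) \<le> u \<bullet> (y - p) / norm u"
          using u by (simp add: field_simps)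
        also have "\<dots> = \<mu>0 * (l * (u \<bullet> (y - p)))"
          using l by (simp add: \<mu>0_def)
        also have "\<dots> \<le> \<mu>0 * F y"
          using l(2)[OF True] \<mu>0 by (intro mult_left_mono) auto
        finally show ?thesis
          using True by (simp add: proj_lagrangian_def h)
      next
        \<comment> \<open>Strict positivity of \<open>\<mu>0\<close> matters here:
          \<open>0 * \<infinity>\<close> would be 0.\<close>
        case False
        then show ?thesis using \<mu>0 by (simp add: proj_lagrangian_def h)
      qed
    qed
    have "optimal_multiplier h x \<mu>0"
      unfolding optimal_multiplier_def using \<mu>0 dual_le dual_ge
      by (meson less_imp_le order_trans)
    moreover have "ereal \<mu> \<le> \<gamma>" if opt: "optimal_multiplier h x \<mu>" for \<mu>
    proof -
      \<comment> \<open>An optimal \<open>\<mu>\<close> does at least as well as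
        \<open>\<mu>0\<close>, so its dual value reaches \<open>norm u\<close>, the Lagrangian value
        at \<open>p\<close>.\<close>
      have \<mu>: "0 \<le> \<mu>" "ereal (norm u) \<le> proj_dual h x \<mu>"
        using opt \<mu>0 dual_ge unfolding optimal_multiplier_def
        by (meson less_imp_le order_trans)+
      have min: "norm u \<le> norm (x - y) + \<mu> * F y" if "y \<in> Y" for y
      proof -
        have "ereal (norm u) \<le> proj_lagrangian h x y \<mu>"
          using \<mu>(2) unfolding proj_dual_def by (meson INF_lower UNIV_I order_trans)
        then show ?thesis
          using that by (simp add: proj_lagrangian_def h)
      qed
      \<comment> \<open>For \<open>\<mu> = 0\<close> the Lagrangian vanishes at
        \<open>y = x\<close>, below \<open>norm u\<close>.\<close>
      have "\<mu> \<noteq> 0"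
        using min[OF x(1)] u by auto
      with \<mu> have pos: "0 < \<mu>" by simp
      define v where "v = (1 / (\<mu> * norm u)) *\<^sub>R u"
      have "v \<bullet> (y - p) \<le> F y" if "y \<in> Y" for y
      proof -
        have "u \<bullet> (y - p) / norm u \<le> \<mu> * F y"
          using first_order_norm_add_convex[OF F(1) p(1,2) that \<mu>(1) p(3)] min
          unfolding u_def by blast
        then show ?thesis
          using pos u by (simp add: v_def field_simps)
      qed
      then have "v \<in> subdiff h p"
        using p by (auto simp: subdiff_def h)
      then have "ereal (1 / norm v) \<le> \<gamma>"
        using p by (intro \<gamma>(3)[of v p]) (auto simp: h)
      moreover have "1 / norm v = \<mu>"
        using pos u by (simp add: v_def)
      ultimately show ?thesis by simp
    qed
    ultimately show ?thesis by blast
  qed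
  have "\<exists>\<mu>. optimal_multiplier h x \<mu> \<and> ereal \<mu> \<le> \<gamma>" if "x \<in> Y" for x
    using inside[of x] outside[OF that] \<gamma>(1) by (cases "x \<in> X \<inter> Y") (auto simp: zero_ereal_def)
  then have "\<exists>\<mu>. \<forall>x\<in>Y. optimal_multiplier h x (\<mu> x) \<and> ereal (\<mu> x) \<le> \<gamma>"
    by (intro bchoice) blast
  with inside outside \<gamma>(2) show ?thesis by blast
qed

end
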